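(* $\mathrm{cov}^*(\mathcal N)\ge\kappa^*$ and $\mathrm{non}^*(\mathcal N)\le\lambda^*$.
   Context: Let $\mathcal N$ be the ideal of Lebesgue null subsets of $\mathbb R$, $\mathcal N_2$ the ideal of null subsets of $\mathbb R\times\mathbb R$, and $\mathrm{Borel}(\mathbb R)$ the set of Borel maps $\mathbb R\to\mathbb R$. $\mathrm{cov}^*(\mathcal N)$ is the minimal $|\mathcal A|$ with $\mathcal A\subseteq\mathcal N_2$ such that for every $f\in\mathrm{Borel}(\mathbb R)$ and every Borel non-null $B\subseteq\mathbb R$ there is $H\in\mathcal A$ with $\{x\in B:\langle x,f(x)\rangle\in H\}\notin\mathcal N$; $\mathrm{non}^*(\mathcal N)$ is the minimal $|X|$ with $X\subseteq\mathrm{Borel}(\mathbb R)$ such that for every $H\in\mathcal N_2$ and every Borel non-null $B$ there is $f\in X$ with $\{x\in B:\langle x,f(x)\rangle\notin H\}\notin\mathcal N$. For $f\in(\omega\setminus\{0\})^\omega$ let $S_f=\prod_n f(n)$ and for $\eta_0,\eta_1\in S_f$ let $\eta_0R^\exists_f\eta_1$ iff $\eta_0(n)=\eta_1(n)$ for infinitely many $n$; $\mathfrak d(R^\exists_f)$ is the least size of $Y\subseteq S_f$ such that every $x\in S_f$ satisfies $xR^\exists_f y$ for some $y\in Y$, and $\mathfrak b(R^\exists_f)$ is the least size of $X\subseteq S_f$ such that for every $y\in S_f$ some $x\in X$ has $\neg xR^\exists_f y$. Then $\kappa^*=\sup\{\mathfrak d(R^\exists_f):f\in(\omega\setminus\{0\})^\omega\}$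 and $\lambda^*=\inf\{\mathfrak b(R^\exists_f):f\in(\omega\setminus\{0\})^\omega\}$. *)

theory Defs
  imports "HOL-Analysis.Analysis"
begin

unbundle cardinal_syntax

text \<open>
  Cardinals are represented by cardinal orders and compared by \<open>\<le>o\<close>. The minimum of a
  nonempty set of cardinal orders is determined only up to \<open>=o\<close>; for the empty set
  \<open>card_Inf\<close> is a junk value.
\<close>

definition card_Inf :: "'a rel set \<Rightarrow> 'a rel" where
  "card_Inf R = (SOME r. r \<in> R \<and> (\<forall>s\<in>R. r \<le>o s))"

text \<open>
  Searching for upper bounds among subsets of \<open>'a\<close> loses nothing, because every cardinal
  order on \<open>'a\<close> is bounded by that of the whole type.
\<close>

definition card_Sup :: "'a rel set \<Rightarrow> 'a rel" where
  "card_Sup R = card_Inf {|A| |A. \<forall>r\<in>R. r \<le>o |A|}"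

lemma card_Inf:
  assumes "R \<noteq> {}" and "\<And>r. r \<in> R \<Longrightarrow> Card_order r"
  shows "card_Inf R \<in> R" and "\<And>s. s \<in> R \<Longrightarrow> card_Inf R \<le>o s"
proof -
  have "\<exists>r. r \<in> R \<and> (\<forall>s\<in>R. r \<le>o s)"
    using exists_minim_Card_order[of R] assms by blast
  then have *: "card_Inf R \<in> R \<and> (\<forall>s\<in>R. card_Inf R \<le>o s)"
    unfolding card_Inf_def by (rule someI_ex)
  show "card_Inf R \<in> R" and "\<And>s. s \<in> R \<Longrightarrow> card_Inf R \<le>o s"
    using * by auto
qed

lemma card_Sup:
  fixes R :: "'a rel set"
  assumes "\<And>r. r \<in> R \<Longrightarrow> Card_order r"
  shows card_Sup_Card_order: "Card_order (card_Sup R)"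
    and card_Sup_upper: "\<And>r. r \<in> R \<Longrightarrow> r \<le>o card_Sup R"
    and card_Sup_least: "\<And>t :: 'b rel. Card_order t \<Longrightarrow> (\<And>r. r \<in> R \<Longrightarrow> r \<le>o t) \<Longrightarrow> card_Sup R \<le>o t"
proof -
  let ?U = "{|A| |A :: 'a set. \<forall>r\<in>R. r \<le>o |A|}"
  have bound: "r \<le>o |UNIV :: 'a set|" if "r \<in> R" for r
    using assms[OF that] card_of_Field_ordIso[of r] card_of_mono1[of "Field r" UNIV]
      ordIso_symmetric ordIso_ordLeq_trans by blast
  then have ne: "?U \<noteq> {}" by blast
  have co: "\<And>u. u \<in> ?U \<Longrightarrow> Card_order u" using card_of_Card_order by blast
  note inf = card_Inf[OF ne co, folded card_Sup_def]
  show "Card_order (card_Sup R)" using inf(1) co by blast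
  show "\<And>r. r \<in> R \<Longrightarrow> r \<le>o card_Sup R" using inf(1) by auto
  fix t :: "'b rel"
  assume t: "Card_order t" and ub: "\<And>r. r \<in> R \<Longrightarrow> r \<le>o t"
  show "card_Sup R \<le>o t"
  proof (cases "|UNIV :: 'a set| \<le>o t")
    case True
    have "card_Sup R \<le>o |UNIV :: 'a set|" using inf(2) bound by blast
    then show ?thesis using True ordLeq_transitive by blast
  next
    case False
    then have "t \<le>o |UNIV :: 'a set|"
      using t card_of_Well_order ordLeq_total unfolding card_order_on_def by blast
    then have "|Field t| \<le>o |UNIV :: 'a set|"
      using card_of_Field_ordIso[OF t] ordIso_ordLeq_trans by blast
    then obtain g :: "'b \<Rightarrow> 'a" where "inj_on g (Field t)"
      using card_of_ordLeq[of "Field t" "UNIV :: 'a set"] by blast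
    then have "|Field t| =o |g ` Field t|"
      using card_of_ordIso inj_on_imp_bij_betw by blast
    then have iso: "t =o |g ` Field t|"
      using card_of_Field_ordIso[OF t] ordIso_symmetric ordIso_transitive by blast
    then have "card_Sup R \<le>o |g ` Field t|"
      using inf(2) ub ordLeq_ordIso_trans by blast
    then show ?thesis using iso ordIso_symmetric ordLeq_ordIso_trans by blast
  qed
qed

definition cov_star_family :: "(real \<times> real) set set \<Rightarrow> bool" where
  "cov_star_family \<A> \<longleftrightarrow> \<A> \<subseteq> null_sets lebesgue \<and>
     (\<forall>f \<in> borel \<rightarrow>\<^sub>M borel. \<forall>B \<in> sets borel - null_sets lebesgue.
        \<exists>H\<in>\<A>. {x \<in> B. (x, f x) \<in> H} \<notin> null_sets lebesgue)"

definition cov_star :: "(real \<times> real) set rel" where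
  "cov_star = card_Inf {|\<A>| |\<A>. cov_star_family \<A>}"

definition non_star_family :: "(real \<Rightarrow> real) set \<Rightarrow> bool" where
  "non_star_family X \<longleftrightarrow> X \<subseteq> borel \<rightarrow>\<^sub>M borel \<and>
     (\<forall>H \<in> null_sets lebesgue. \<forall>B \<in> sets borel - null_sets lebesgue.
        \<exists>f\<in>X. {x \<in> B. (x, f x) \<notin> H} \<notin> null_sets lebesgue)"

definition non_star :: "(real \<Rightarrow> real) rel" where
  "non_star = card_Inf {|X| |X. non_star_family X}"

definition S :: "(nat \<Rightarrow> nat) \<Rightarrow> (nat \<Rightarrow> nat) set" where
  "S f = (\<Pi> n\<in>UNIV. {..<f n})"

definition R_ex :: "(nat \<Rightarrow> nat) \<Rightarrow> (nat \<Rightarrow> nat) \<Rightarrow> bool" where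
  "R_ex \<eta>\<^sub>0 \<eta>\<^sub>1 \<longleftrightarrow> infinite {n. \<eta>\<^sub>0 n = \<eta>\<^sub>1 n}"

definition dominating :: "(nat \<Rightarrow> nat) \<Rightarrow> (nat \<Rightarrow> nat) set \<Rightarrow> bool" where
  "dominating f Y \<longleftrightarrow> Y \<subseteq> S f \<and> (\<forall>x\<in>S f. \<exists>y\<in>Y. R_ex x y)"

definition unbounded :: "(nat \<Rightarrow> nat) \<Rightarrow> (nat \<Rightarrow> nat) set \<Rightarrow> bool" where
  "unbounded f X \<longleftrightarrow> X \<subseteq> S f \<and> (\<forall>y\<in>S f. \<exists>x\<in>X. \<not> R_ex x y)"

definition d_R :: "(nat \<Rightarrow> nat) \<Rightarrow> (nat \<Rightarrow> nat) rel" where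
  "d_R f = card_Inf {|Y| |Y. dominating f Y}"

definition b_R :: "(nat \<Rightarrow> nat) \<Rightarrow> (nat \<Rightarrow> nat) rel" where
  "b_R f = card_Inf {|X| |X. unbounded f X}"

definition kappa_star :: "(nat \<Rightarrow> nat) rel" where
  "kappa_star = card_Sup {d_R f |f. \<forall>n. f n \<noteq> 0}"

text \<open>
  If \<open>f n = 1\<close> for infinitely many \<open>n\<close>, then any two members of \<open>S f\<close> are related, no
  unbounded family exists, and the bounding number is \<open>\<infinity>\<close> by the usual convention
  \<open>min \<emptyset> = \<infinity>\<close>. Such \<open>f\<close> do not contribute to the infimum and are left out.
\<close>

definition lambda_star :: "(nat \<Rightarrow> nat) rel" where
  "lambda_star = card_Inf {b_R f |f. (\<forall>n. f n \<noteq> 0) \<and> (\<exists>X. unbounded f X)}"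

lemma dominating_S: "dominating f (S f)"
proof -
  have "R_ex x x" for x by (simp add: R_ex_def)
  then show ?thesis unfolding dominating_def by blast
qed

lemma unbounded_S_iff:
  assumes "\<forall>n. f n \<noteq> 0"
  shows "(\<exists>X. unbounded f X) \<longleftrightarrow> finite {n. f n = 1}"
proof
  assume "\<exists>X. unbounded f X"
  then obtain X where X: "X \<subseteq> S f" "\<And>y. y \<in> S f \<Longrightarrow> \<exists>x\<in>X. \<not> R_ex x y"
    unfolding unbounded_def by blast
  have "(\<lambda>_. 0) \<in> S f" using assms by (simp add: S_def)
  then obtain x where "x \<in> X" and fin: "finite {n. x n = 0}"
    using X(2)[of "\<lambda>_. 0"] unfolding R_ex_def by auto
  have "x n = 0" if "f n = 1" for n
  proof -
    have "x n < f n" using \<open>x \<in> X\<close> X(1) by (auto simp: S_def)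
    then show ?thesis using that by simp
  qed
  then show "finite {n. f n = 1}" using fin by (auto intro: rev_finite_subset)
next
  assume fin: "finite {n. f n = 1}"
  have "\<exists>x\<in>S f. \<not> R_ex x y" if "y \<in> S f" for y
  proof
    let ?x = "\<lambda>n. if f n = 1 \<or> y n \<noteq> 0 then 0 else 1"
    have "f n = 1 \<or> f n > 1" for n using assms by (metis less_one linorder_neqE_nat)
    then show "?x \<in> S f" using assms by (auto simp: S_def) metis
    have "{n. ?x n = y n} \<subseteq> {n. f n = 1}" by (auto split: if_splits)
    then show "\<not> R_ex ?x y" unfolding R_ex_def using fin finite_subset by blast
  qed
  then show "\<exists>X. unbounded f X" unfolding unbounded_def by blast
qed

lemma cov_star_family_null_sets: "cov_star_family (null_sets lebesgue)"
  unfolding cov_star_family_def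
proof (intro conjI ballI)
  fix f :: "real \<Rightarrow> real" and B :: "real set"
  assume f: "f \<in> borel \<rightarrow>\<^sub>M borel" and B: "B \<in> sets borel - null_sets lebesgue"
  let ?G = "{p :: real \<times> real. snd p = f (fst p)}"
  have meas: "?G \<in> sets (lborel \<Otimes>\<^sub>M lborel)"
  proof -
    have [measurable]: "f \<in> borel_measurable borel" using f .
    have "Measurable.pred (lborel \<Otimes>\<^sub>M lborel) (\<lambda>p. snd p = f (fst p))"
      by measurable
    then show ?thesis by (simp add: pred_def space_pair_measure)
  qed
  have sec: "Pair x -` ?G = {f x}" for x by auto
  have "emeasure (lborel \<Otimes>\<^sub>M lborel) ?G = 0"
    by (subst lborel.emeasure_pair_measure_alt[OF meas]) (simp add: sec)
  then have "?G \<in> null_sets lborel"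
    using meas unfolding lborel_prod by (rule null_setsI)
  then have "?G \<in> null_sets lebesgue" by (rule null_sets_completionI)
  moreover have "{x \<in> B. (x, f x) \<in> ?G} \<notin> null_sets lebesgue" using B by simp
  ultimately show "\<exists>H\<in>null_sets lebesgue. {x \<in> B. (x, f x) \<in> H} \<notin> null_sets lebesgue"
    by blast
qed simp

lemma non_star_family_borel: "non_star_family (borel \<rightarrow>\<^sub>M borel)"
  unfolding non_star_family_def
proof (intro conjI ballI)
  fix H :: "(real \<times> real) set" and B :: "real set"
  assume H: "H \<in> null_sets lebesgue" and B: "B \<in> sets borel - null_sets lebesgue"
  obtain N where N: "N \<in> null_sets lborel" "H \<subseteq> N"
    using H unfolding null_sets_completion_iff2 by auto
  then have "AE p in lborel \<Otimes>\<^sub>M lborel. p \<notin> N"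
    unfolding lborel_prod using AE_not_in by auto
  then have ae: "AE x in lborel. AE y in lborel. (x, y) \<notin> N"
    by (rule lborel_pair.AE_pair)
  have "N \<in> sets (lborel \<Otimes>\<^sub>M lborel)"
    unfolding lborel_prod using N(1) by (rule null_setsD2)
  then have "{p \<in> space (lborel \<Otimes>\<^sub>M lborel). (fst p, snd p) \<notin> N} \<in> sets (lborel \<Otimes>\<^sub>M lborel)"
    unfolding prod.collapse set_diff_eq[symmetric] by (rule sets.compl_sets)
  then have "AE y in lborel. AE x in lborel. (x, y) \<notin> N"
    using ae by (rule lborel_pair.AE_commute[where P = "\<lambda>x y. (x, y) \<notin> N", THEN iffD1])
  moreover have "ae_filter (lborel :: real measure) \<noteq> bot"
    by (simp add: ae_filter_eq_bot_iff)
  ultimately obtain y where "AE x in lborel. (x, y) \<notin> N"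
    using eventually_happens' by blast
  then obtain M where "{x. (x, y) \<in> N} \<subseteq> M" "M \<in> null_sets lborel"
    by (elim AE_E) (simp add: null_setsI)
  then have M: "{x. (x, y) \<in> H} \<subseteq> M" "negligible M"
    using N(2) null_sets_completionI[of M lborel] by (auto simp: negligible_iff_null_sets)
  have "\<not> negligible {x \<in> B. (x, y) \<notin> H}"
  proof
    assume "negligible {x \<in> B. (x, y) \<notin> H}"
    then have "negligible ({x \<in> B. (x, y) \<notin> H} \<union> M)"
      using M(2) by (rule negligible_Un)
    then have "negligible B"
      by (rule negligible_subset) (use M(1) in auto)
    then show False using B by (simp add: negligible_iff_null_sets)
  qed
  then have "{x \<in> B. (x, y) \<notin> H} \<notin> null_sets lebesgue"
    by (simp add: negligible_iff_null_sets)
  then show "\<exists>f\<in>borel \<rightarrow>\<^sub>M borel. {x \<in> B. (x, f x) \<notin> H} \<notin> null_sets lebesgue"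
    by (intro bexI[of _ "\<lambda>_. y"]) auto
qed simp

end

theory Submission
  imports Defs
begin

text \<open>
  Both inequalities come from one construction: maps \<open>\<eta> \<mapsto> F\<^sub>\<eta>\<close> from \<open>S f\<close> to Borel functions and
  \<open>H \<mapsto> \<psi>\<close> from plane null sets to \<open>S f\<close> such that the graph of \<open>F\<^sub>\<eta>\<close> meets \<open>H\<close> only over
  a null set unless \<open>\<eta>\<close> and \<open>\<psi>\<close> agree infinitely often.

  Partition the natural numbers into consecutive blocks. The \<open>n\<close>-th binary digit of
  \<open>F\<^sub>\<eta> x\<close> is given by the Rademacher function at \<open>x\<close> whose index codes the restriction of
  \<open>\<eta>\<close> to the blocks up to the \<open>n\<close>-th. Cover \<open>H\<close> by open sets \<open>U\<^sub>k\<close> of measure at most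
  \<open>4\<^sup>-\<^sup>k\<close> and let \<open>a\<^sub>n\<close> be the average over \<open>x\<close> of the density of the section of \<open>U\<^sub>k\<close> in
  the dyadic interval determined by the first \<open>n\<close> digits of \<open>F\<^sub>\<eta> x\<close>. The increment
  \<open>a\<^sub>n\<^sub>+\<^sub>1 - a\<^sub>n\<close> is an inner product with the new Rademacher function, so by Bessel's
  inequality it exceeds \<open>2\<^sup>-\<^sup>n\<close> for at most \<open>4\<^sup>n\<close> continuations of a given history. As this
  bound does not depend on the number of continuations, the \<open>n\<close>-th block can be chosen so
  long that \<open>\<psi>\<close> agrees somewhere in it with every exceptional continuation, for all
  histories and all \<open>k \<le> n\<close>. If \<open>\<eta>\<close> and \<open>\<psi>\<close> agree only finitely often, then
  \<open>a\<^sub>n \<le> 3 / 2\<^sup>k\<close> for large \<open>k \<le> n\<close>, and in the limit the graph of \<open>F\<^sub>\<eta>\<close> lies in \<open>U\<^sub>k\<close> only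
  over a set of measure at most \<open>3 / 2\<^sup>k\<close>.
\<close>

section \<open>Rademacher functions\<close>

definition rademacher :: "nat \<Rightarrow> real \<Rightarrow> real" where
  "rademacher j x = (if even \<lfloor>2 ^ Suc j * x\<rfloor> then 1 else - 1)"

abbreviation unit_measure :: "real measure" where
  "unit_measure \<equiv> restrict_space lborel {0..<1}"

interpretation unit_measure: finite_measure unit_measure
  by (rule finite_measureI) (simp add: emeasure_restrict_space space_restrict_space)

lemma space_unit_measure [simp]: "space unit_measure = {0..<1}"
  by (simp add: space_restrict_space)

lemma measure_unit_measure [simp]: "measure unit_measure {0..<1} = 1"
  by (simp add: measure_restrict_space)

lemma borel_measurable_rademacher [measurable]: "rademacher j \<in> borel_measurable borel"
  unfolding rademacher_def by measurable

lemma borel_measurable_unit_measure: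
  "f \<in> borel_measurable borel \<Longrightarrow> f \<in> borel_measurable unit_measure"
  by (rule measurable_restrict_space1) simp

lemma integrable_unit_measure:
  fixes f :: "real \<Rightarrow> real"
  assumes "f \<in> borel_measurable borel" and "\<And>x. \<bar>f x\<bar> \<le> B"
  shows "integrable unit_measure f"
  using assms
  by (intro unit_measure.integrable_const_bound[where B = B] borel_measurable_unit_measure) auto

lemma rademacher_mult_self [simp]: "rademacher j x * rademacher j x = 1"
  by (simp add: rademacher_def)

lemma abs_rademacher [simp]: "\<bar>rademacher j x\<bar> = 1"
  by (simp add: rademacher_def)

text \<open>As the floor is even, the shift stays inside one dyadic interval of length
  \<open>1 / 2 ^ j\<close>, where \<open>rademacher i\<close> is constant for
  \<open>i < j\<close>.\<close>

lemma rademacher_shift: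
  assumes "i < j" and "even \<lfloor>2 ^ Suc j * x\<rfloor>"
  shows "rademacher i (x + 1 / 2 ^ Suc j) = rademacher i x"
proof -
  let ?d = "2 ^ (j - i) :: int"
  have sc: "2 ^ Suc i * y = (2 ^ Suc j * y) / real_of_int ?d" for y :: real
  proof -
    have "(2::real) ^ Suc j = 2 ^ Suc i * 2 ^ (j - i)"
      using assms(1) by (simp flip: power_add)
    then show ?thesis by (simp add: field_simps)
  qed
  have fl: "\<lfloor>2 ^ Suc i * y\<rfloor> = \<lfloor>2 ^ Suc j * y\<rfloor> div ?d" for y :: real
    by (subst sc) (rule floor_divide_real_eq_div, simp)
  have sh: "\<lfloor>2 ^ Suc j * (x + 1 / 2 ^ Suc j)\<rfloor> = \<lfloor>2 ^ Suc j * x\<rfloor> + 1"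
    by (simp add: distrib_left)
  have "?d = 2 * 2 ^ (j - Suc i)"
    using assms(1) by (metis Suc_diff_Suc power_Suc)
  then have "(\<lfloor>2 ^ Suc j * x\<rfloor> + 1) div ?d = \<lfloor>2 ^ Suc j * x\<rfloor> div ?d"
    using assms(2) by (simp add: zdiv_zmult2_eq)
  then show ?thesis unfolding rademacher_def fl sh by simp
qed

text \<open>Translation by \<open>h\<close> carries the positive part \<open>A\<close> of
  \<open>rademacher j\<close> onto its negative part \<open>B\<close> and preserves the values of
  \<open>rademacher i\<close>, so the two contributions cancel.\<close>

lemma rademacher_orthogonal_less:
  assumes "i < j"
  shows "(\<integral>x. rademacher i x * rademacher j x \<partial>unit_measure) = 0"
proof -
  define q where "q x = \<lfloor>2 ^ Suc j * x\<rfloor>" for x :: real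
  define A where "A = {x. 0 \<le> x \<and> x < 1 \<and> even (q x)}"
  define B where "B = {x. 0 \<le> x \<and> x < 1 \<and> odd (q x)}"
  define h :: real where "h = 1 / 2 ^ Suc j"
  have [measurable]: "A \<in> sets borel" "B \<in> sets borel"
    unfolding A_def B_def q_def by measurable
  have sub: "A \<subseteq> {0..<1}" "B \<subseteq> {0..<1}" by (auto simp: A_def B_def)
  have unit_iff: "0 \<le> x \<and> x < 1 \<longleftrightarrow> 0 \<le> q x \<and> q x < 2 ^ Suc j" for x
  proof -
    have "x < 1 \<longleftrightarrow> 2 ^ Suc j * x < 2 ^ Suc j" by simp
    also have "\<dots> \<longleftrightarrow> q x < 2 ^ Suc j" unfolding q_def by (simp add: floor_less_iff)
    finally show ?thesis
      using mult_le_cancel_left_pos[of "2 ^ Suc j" 0 x] unfolding q_def by simp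
  qed
  have q_h: "q (x + h) = q x + 1" for x
    unfolding q_def h_def by (simp add: distrib_left)
  have B_h: "x + h \<in> B \<longleftrightarrow> x \<in> A" for x
  proof -
    \<comment> \<open>Both \<open>0\<close> and \<open>2 ^ Suc j\<close> are even, so passing from
      an even \<open>k\<close> to \<open>k + 1\<close> crosses neither end of the range.\<close>
    have "even k \<Longrightarrow> k + 1 < 2 ^ Suc j \<longleftrightarrow> k < 2 ^ Suc j" for k :: int
      by (auto elim!: evenE)
    moreover have "even k \<Longrightarrow> 0 \<le> k + 1 \<longleftrightarrow> 0 \<le> k" for k :: int
      by (auto elim!: evenE)
    ultimately show ?thesis
      unfolding A_def B_def mem_Collect_eq unit_iff conj_assoc[symmetric] q_h by auto
  qed
  have int: "integrable lborel (\<lambda>x. indicator C x * rademacher i x)"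
    if "C \<in> sets borel" "C \<subseteq> {0..<1}" for C
  proof (rule integrableI_bounded_set[where A = "{0..<1}" and B = 1])
    show "AE x in lborel. x \<in> {0..<1} \<longrightarrow> norm (indicator C x * rademacher i x) \<le> 1"
      by (auto simp: indicator_def)
  qed (use that in \<open>auto simp: indicator_def intro!: AE_I2\<close>)
  have "(\<integral>x. indicator B x * rademacher i x \<partial>lborel)
      = (\<integral>x. indicator B (h + x) * rademacher i (h + x) \<partial>lborel)"
    by (subst lborel_integral_real_affine[where c = 1 and t = h]) auto
  also have "\<dots> = (\<integral>x. indicator A x * rademacher i x \<partial>lborel)"
  proof (rule Bochner_Integration.integral_cong[OF refl])
    fix x
    show "indicator B (h + x) * rademacher i (h + x) = indicator A x * rademacher i x"
      using B_h[of x] rademacher_shift[OF assms, of x]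
      by (auto simp: indicator_def add.commute h_def A_def q_def)
  qed
  finally have eq: "(\<integral>x. indicator B x * rademacher i x \<partial>lborel)
    = (\<integral>x. indicator A x * rademacher i x \<partial>lborel)" .
  have "(\<integral>x. rademacher i x * rademacher j x \<partial>unit_measure)
      = (\<integral>x. indicator {0..<1} x *\<^sub>R (rademacher i x * rademacher j x) \<partial>lborel)"
    by (rule integral_restrict_space) simp
  also have "\<dots> = (\<integral>x. indicator A x * rademacher i x - indicator B x * rademacher i x \<partial>lborel)"
    by (rule Bochner_Integration.integral_cong)
      (auto simp: indicator_def A_def B_def rademacher_def[of j] q_def)
  also have "\<dots> = 0"
    using eq int[of A] int[of B] sub by (subst Bochner_Integration.integral_diff) auto
  finally show ?thesis .
qed

lemma rademacher_orthogonal: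
  "(\<integral>x. rademacher i x * rademacher j x \<partial>unit_measure) = (if i = j then 1 else 0)"
  using rademacher_orthogonal_less[of i j] rademacher_orthogonal_less[of j i]
  by (cases i j rule: linorder_cases) (auto simp: mult.commute)

text \<open>With \<open>s\<close> the sum over \<open>J\<close>, orthonormality bounds the
  nonnegative integral of \<open>(c x - e * s x)\<^sup>2\<close> by
  \<open>1 - e\<^sup>2 * card J\<close>.\<close>

lemma rademacher_bessel_finite:
  assumes [measurable]: "c \<in> borel_measurable borel" and c: "\<And>x. \<bar>c x\<bar> \<le> 1"
    and "finite J" and e: "0 < e"
    and J: "\<And>j. j \<in> J \<Longrightarrow> e < (\<integral>x. c x * rademacher j x \<partial>unit_measure)"
  shows "real (card J) * e\<^sup>2 \<le> 1"
proof -
  define s where "s x = (\<Sum>j\<in>J. rademacher j x)" for x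
  have [measurable]: "s \<in> borel_measurable borel" unfolding s_def by measurable
  have s: "\<bar>s x\<bar> \<le> card J" for x
    unfolding s_def by (rule order_trans[OF sum_abs]) simp
  have cr: "integrable unit_measure (\<lambda>x. c x * rademacher j x)" for j
    by (rule integrable_unit_measure[where B = 1]) (auto simp: abs_mult c)
  have cc: "integrable unit_measure (\<lambda>x. c x * c x)"
    using c by (intro integrable_unit_measure[where B = 1])
      (auto simp: abs_square_le_1 simp flip: power2_eq_square)
  have cs: "integrable unit_measure (\<lambda>x. c x * s x)"
    unfolding s_def sum_distrib_left by (intro Bochner_Integration.integrable_sum cr)
  have rr: "integrable unit_measure (\<lambda>x. rademacher i x * rademacher j x)" for i j
    by (rule integrable_unit_measure[where B = 1]) (auto simp: abs_mult)
  have ss: "integrable unit_measure (\<lambda>x. s x * s x)"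
    unfolding s_def sum_product by (intro Bochner_Integration.integrable_sum rr)
  have "(\<integral>x. s x * s x \<partial>unit_measure)
      = (\<Sum>i\<in>J. \<Sum>j\<in>J. \<integral>x. rademacher i x * rademacher j x \<partial>unit_measure)"
    unfolding s_def sum_product by (simp add: Bochner_Integration.integral_sum rr)
  also have "\<dots> = card J"
    unfolding rademacher_orthogonal using \<open>finite J\<close> by simp
  finally have iss: "(\<integral>x. s x * s x \<partial>unit_measure) = card J" .
  have "card J * e \<le> (\<Sum>j\<in>J. \<integral>x. c x * rademacher j x \<partial>unit_measure)"
    using J by (intro sum_bounded_below[where K = e, simplified]) (auto intro: less_imp_le)
  also have "\<dots> = (\<integral>x. c x * s x \<partial>unit_measure)"
    unfolding s_def sum_distrib_left by (simp add: Bochner_Integration.integral_sum cr)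
  finally have ics: "card J * e \<le> (\<integral>x. c x * s x \<partial>unit_measure)" .
  have icc: "(\<integral>x. c x * c x \<partial>unit_measure) \<le> 1"
  proof -
    have "(\<integral>x. c x * c x \<partial>unit_measure) \<le> (\<integral>x. 1 \<partial>unit_measure)"
    proof (rule integral_mono[OF cc])
      fix x
      show "c x * c x \<le> 1"
        using c[of x] by (simp add: abs_square_le_1 flip: power2_eq_square)
    qed simp
    then show ?thesis by simp
  qed
  have "0 \<le> (\<integral>x. (c x - e * s x)\<^sup>2 \<partial>unit_measure)" by simp
  also have "\<dots> = (\<integral>x. c x * c x - 2 * e * (c x * s x) + e\<^sup>2 * (s x * s x) \<partial>unit_measure)"
    by (simp add: power2_eq_square algebra_simps)
  also have "\<dots> = (\<integral>x. c x * c x \<partial>unit_measure) - 2 * e * (\<integral>x. c x * s x \<partial>unit_measure)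
      + e\<^sup>2 * card J"
    using cc cs ss iss by simp
  also have "\<dots> \<le> 1 - 2 * e * (card J * e) + e\<^sup>2 * card J"
    using icc ics e by (intro add_mono diff_mono mult_left_mono) auto
  finally show ?thesis by (simp add: power2_eq_square algebra_simps)
qed

text \<open>All finite subsets of \<open>J n\<close> obey one bound, so \<open>J n\<close> is
  finite. The bound does not depend on \<open>c\<close>, which lets the blocks be fixed before
  \<open>H\<close> is given.\<close>

lemma rademacher_bessel:
  assumes "c \<in> borel_measurable borel" and "\<And>x. \<bar>c x\<bar> \<le> 1"
  defines "J \<equiv> \<lambda>n. {j. 1 / 2 ^ n < (\<integral>x. c x * rademacher j x \<partial>unit_measure)}"
  shows "finite (J n)" and "card (J n) \<le> 4 ^ n"
proof -
  have *: "card K \<le> 4 ^ n" if "finite K" "K \<subseteq> J n" for K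
  proof -
    have "real (card K) * (1 / 2 ^ n)\<^sup>2 \<le> 1"
      using that assms by (intro rademacher_bessel_finite) auto
    then have "real (card K) \<le> (2 ^ n)\<^sup>2" by (simp add: power_divide field_simps)
    then have "real (card K) \<le> 4 ^ n" by (simp add: power2_eq_square flip: power_mult_distrib)
    then show ?thesis using of_nat_le_iff[of "card K" "4 ^ n", where 'a = real] by simp
  qed
  show "finite (J n)"
    using * infinite_arbitrarily_large[of "J n" "Suc (4 ^ n)"] by (metis Suc_n_not_le_n)
  then show "card (J n) \<le> 4 ^ n" using * by blast
qed

section \<open>Densities on dyadic intervals\<close>

text \<open>
  \<open>dens U n k x\<close> is the relative measure of the vertical section of \<open>U\<close> at \<open>x\<close> in the
  dyadic interval \<open>[k / 2 ^ n, (k + 1) / 2 ^ n)\<close>.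
\<close>

definition dens :: "(real \<times> real) set \<Rightarrow> nat \<Rightarrow> real \<Rightarrow> real \<Rightarrow> real" where
  "dens U n k x = 2 ^ n * measure lborel {y \<in> {k / 2 ^ n..<(k + 1) / 2 ^ n}. (x, y) \<in> U}"

lemma sets_vimage_Pair:
  fixes U :: "(real \<times> real) set"
  assumes "U \<in> sets borel"
  shows "Pair x -` U \<in> sets borel"
  using sets_Pair1[of U borel borel x] assms unfolding borel_prod by simp

lemma sets_section:
  fixes U :: "(real \<times> real) set"
  assumes "U \<in> sets borel"
  shows "{y \<in> {a..<b}. (x, y) \<in> U} \<in> sets borel"
proof -
  have "Pair x -` U \<inter> {a..<b} \<in> sets borel"
    using sets_vimage_Pair[OF assms, of x] by simp
  moreover have "{y \<in> {a..<b}. (x, y) \<in> U} = Pair x -` U \<inter> {a..<b}" by auto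
  ultimately show ?thesis by simp
qed

lemma borel_measurable_dens [measurable (raw)]:
  assumes U: "U \<in> sets borel" and [measurable]: "g \<in> borel_measurable borel"
  shows "(\<lambda>x. dens U n (g x) x) \<in> borel_measurable borel"
proof -
  let ?V = "{p \<in> space (lborel \<Otimes>\<^sub>M lborel).
    g (fst p) / 2 ^ n \<le> snd p \<and> snd p < (g (fst p) + 1) / 2 ^ n \<and> p \<in> U}"
  have [measurable]: "U \<in> sets (lborel \<Otimes>\<^sub>M lborel)"
    unfolding lborel_prod using U by simp
  have "?V \<in> sets (lborel \<Otimes>\<^sub>M lborel)" by measurable
  from lborel.measurable_emeasure_Pair[OF this]
  have "(\<lambda>x. emeasure lborel (Pair x -` ?V)) \<in> borel_measurable borel" by simp
  moreover have "dens U n (g x) x = 2 ^ n * enn2real (emeasure lborel (Pair x -` ?V))" for x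
    unfolding dens_def measure_def
    by (rule arg_cong[where f = "\<lambda>A. 2 ^ n * enn2real (emeasure lborel A)"])
      (auto simp: space_pair_measure)
  ultimately show ?thesis by simp
qed

lemma fmeasurable_Ico: "{a..<b :: real} \<in> fmeasurable lborel"
proof (rule fmeasurableI)
  have "bounded {a..<b}" by (rule bounded_subset[OF bounded_closed_interval[of a b]]) auto
  then show "emeasure lborel {a..<b} < \<infinity>" by (rule emeasure_bounded_finite)
qed simp

lemma fmeasurable_section:
  fixes U :: "(real \<times> real) set"
  assumes "U \<in> sets borel"
  shows "{y \<in> {a..<b}. (x, y) \<in> U} \<in> fmeasurable lborel"
  by (rule fmeasurableI2[OF fmeasurable_Ico]) (use sets_section[OF assms] in auto)

lemma dens_nonneg: "0 \<le> dens U n k x"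
  by (simp add: dens_def)

lemma dens_le_1:
  assumes "U \<in> sets borel"
  shows "dens U n k x \<le> 1"
proof -
  have "measure lborel {y \<in> {k / 2 ^ n..<(k + 1) / 2 ^ n}. (x, y) \<in> U}
    \<le> measure lborel {k / 2 ^ n..<(k + 1) / 2 ^ n}"
    using sets_section[OF assms] by (intro measure_mono_fmeasurable fmeasurable_Ico) auto
  also have "\<dots> = 1 / 2 ^ n" by (simp add: divide_right_mono add_divide_distrib)
  finally show ?thesis by (simp add: dens_def field_simps)
qed

text \<open>Cutting the interval at its midpoint gives the martingale property of the
  densities.\<close>

lemma dens_Suc:
  assumes "U \<in> sets borel"
  shows "dens U n k x = (dens U (Suc n) (2 * k) x + dens U (Suc n) (2 * k + 1) x) / 2"
proof -
  let ?I = "\<lambda>a b. {y \<in> {a..<b}. (x, y) \<in> U}"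
  let ?a = "k / 2 ^ n" and ?c = "(k + 1) / 2 ^ n" and ?b = "(2 * k + 1) / 2 ^ Suc n"
  have "?a \<le> ?b" "?b \<le> ?c" by (simp_all add: field_simps)
  then have split: "?I ?a ?c = ?I ?a ?b \<union> ?I ?b ?c" by auto
  have m: "measure lborel (?I ?a ?c) = measure lborel (?I ?a ?b) + measure lborel (?I ?b ?c)"
    unfolding split
  proof (rule measure_Union)
    show "?I ?a ?b \<inter> ?I ?b ?c = {}" by auto
  qed (simp_all only: sets_lborel sets_section[OF assms] infinity_ennreal_def
    fmeasurableD2[OF fmeasurable_section[OF assms]] not_False_eq_True)
  have ends: "2 * k / 2 ^ Suc n = ?a" "(2 * k + 1 + 1) / 2 ^ Suc n = ?c"
    by (simp_all add: add_divide_distrib)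
  have "2 ^ n * (u + v) = (2 ^ Suc n * u + 2 ^ Suc n * v) / 2" for u v :: real
    by (simp add: algebra_simps)
  then show ?thesis unfolding dens_def ends m .
qed

lemma dens_le_section:
  assumes "U \<in> sets borel"
  shows "ennreal (dens U n k x) \<le> 2 ^ n * emeasure lborel (Pair x -` U)"
proof -
  have "ennreal (dens U n k x)
      = 2 ^ n * emeasure lborel {y \<in> {k / 2 ^ n..<(k + 1) / 2 ^ n}. (x, y) \<in> U}"
    unfolding dens_def using fmeasurable_section[OF assms]
    by (simp add: ennreal_mult ennreal_power[symmetric] emeasure_eq_measure2 fmeasurableD2)
  also have "\<dots> \<le> 2 ^ n * emeasure lborel (Pair x -` U)"
    using sets_vimage_Pair[OF assms, of x]
    by (intro mult_left_mono emeasure_mono) auto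
  finally show ?thesis .
qed

lemma dens_open:
  assumes "open U" and "(x, y) \<in> U"
    and k: "\<And>n. k n / 2 ^ n \<le> y" "\<And>n. y \<le> (k n + 1) / 2 ^ n"
  shows "eventually (\<lambda>n. dens U n (k n) x = 1) sequentially"
proof -
  obtain e where e: "e > 0" "\<And>z. dist z (x, y) < e \<Longrightarrow> z \<in> U"
    using assms(1,2) unfolding open_dist by blast
  have "(\<lambda>n. (1 / 2 :: real) ^ n) \<longlonglongrightarrow> 0" by (rule LIMSEQ_realpow_zero) auto
  then have "eventually (\<lambda>n. (1 / 2 :: real) ^ n < e) sequentially"
    using e(1) by (rule order_tendstoD)
  then show ?thesis
  proof eventually_elim
    case (elim n)
    have "(x, z) \<in> U" if "z \<in> {k n / 2 ^ n..<(k n + 1) / 2 ^ n}" for z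
    proof (rule e(2))
      have "\<bar>z - y\<bar> \<le> (1 / 2) ^ n"
        using that k[of n] by (auto simp: add_divide_distrib power_one_over)
      then show "dist (x, z) (x, y) < e"
        using elim by (simp add: dist_Pair_Pair dist_real_def)
    qed
    then have "{z \<in> {k n / 2 ^ n..<(k n + 1) / 2 ^ n}. (x, z) \<in> U}
      = {k n / 2 ^ n..<(k n + 1) / 2 ^ n}" by auto
    then show ?case by (simp add: dens_def divide_right_mono add_divide_distrib)
  qed
qed

text \<open>
  The Rademacher functions with indices in the list, most recent first, provide the first
  binary digits of a point; \<open>dyadic is x\<close> is the integer with these digits.
\<close>

primrec dyadic :: "nat list \<Rightarrow> real \<Rightarrow> real" where
  "dyadic [] x = 0"
| "dyadic (i # is) x = 2 * dyadic is x + (1 - rademacher i x) / 2"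

lemma borel_measurable_dyadic [measurable]: "dyadic is \<in> borel_measurable borel"
  by (induction "is") (simp_all add: dyadic.simps[abs_def])

definition mass :: "(real \<times> real) set \<Rightarrow> nat list \<Rightarrow> real" where
  "mass U is = (\<integral>x. dens U (length is) (dyadic is x) x \<partial>unit_measure)"

lemma integrable_dens:
  assumes "U \<in> sets borel"
  shows "integrable unit_measure (\<lambda>x. dens U n (dyadic is x) x)"
  using assms dens_nonneg dens_le_1[OF assms]
  by (intro integrable_unit_measure[where B = 1] borel_measurable_dens) auto

text \<open>Enlarging the dyadic interval to the whole line costs the factor
  \<open>2 ^ length is\<close>; Tonelli does the rest. At level \<open>k\<close> a measure of
  \<open>1 / 4 ^ k\<close> outweighs this factor.\<close>

lemma mass_le:
  assumes "U \<in> sets borel" and "emeasure lborel U \<le> ennreal m" and "0 \<le> m"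
  shows "mass U is \<le> 2 ^ length is * m"
proof -
  let ?n = "length is"
  have U: "U \<in> sets (lborel \<Otimes>\<^sub>M lborel)" unfolding lborel_prod using assms(1) by simp
  have "ennreal (mass U is) = (\<integral>\<^sup>+x. dens U ?n (dyadic is x) x \<partial>unit_measure)"
    unfolding mass_def using integrable_dens[OF assms(1)] dens_nonneg
    by (intro nn_integral_eq_integral[symmetric]) auto
  also have "\<dots> \<le> (\<integral>\<^sup>+x. dens U ?n (dyadic is x) x \<partial>lborel)"
    by (subst nn_integral_restrict_space) (auto intro!: nn_integral_mono simp: indicator_def)
  also have "\<dots> \<le> (\<integral>\<^sup>+x. 2 ^ ?n * emeasure lborel (Pair x -` U) \<partial>lborel)"
    by (intro nn_integral_mono dens_le_section assms)
  also have "\<dots> = 2 ^ ?n * emeasure (lborel \<Otimes>\<^sub>M lborel) U"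
    using lborel.measurable_emeasure_Pair[OF U]
    by (simp add: nn_integral_cmult lborel.emeasure_pair_measure_alt[OF U])
  also have "\<dots> \<le> 2 ^ ?n * ennreal m"
    using assms(2) by (intro mult_left_mono) (auto simp: lborel_prod)
  also have "\<dots> = ennreal (2 ^ ?n * m)"
    using assms(3) by (simp add: ennreal_mult ennreal_power[symmetric])
  finally show ?thesis using assms(3) by simp
qed

text \<open>
  The increment of \<open>mass\<close> is the inner product of a bounded function not depending on \<open>i\<close>
  with the \<open>i\<close>-th Rademacher function, so Bessel's inequality applies.
\<close>

lemma mass_jump:
  fixes n :: nat and "is" :: "nat list"
  assumes "U \<in> sets borel"
  defines "J \<equiv> {i. mass U is + 1 / 2 ^ n < mass U (i # is)}"
  shows "finite J" and "card J \<le> 4 ^ n"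
proof -
  let ?m = "length is"
  let ?D = "\<lambda>k x. dens U (Suc ?m) k x"
  \<comment> \<open>Rademacher value 1 selects the left half and -1 the right; up to this sign,
    \<open>c\<close> is the deviation from the mean density.\<close>
  define c where "c x = (?D (2 * dyadic is x) x - ?D (2 * dyadic is x + 1) x) / 2" for x
  have [measurable]: "c \<in> borel_measurable borel"
    unfolding c_def using assms(1) by measurable
  have c: "\<bar>c x\<bar> \<le> 1" for x
  proof -
    have "\<bar>(a - b) / 2\<bar> \<le> 1" if "0 \<le> a" "a \<le> 1" "0 \<le> b" "b \<le> 1" for a b :: real
      using that by (intro abs_leI) auto
    then show ?thesis
      unfolding c_def by (simp only: dens_nonneg dens_le_1[OF assms(1)])
  qed
  have eq: "dens U (Suc ?m) (dyadic (i # is) x) x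
      = dens U ?m (dyadic is x) x + c x * rademacher i x" for i x
  proof -
    have *: "(u + v) / 2 + (u - v) / 2 = u" "(u + v) / 2 - (u - v) / 2 = v" for u v :: real
      by (simp_all add: field_simps)
    have "rademacher i x = 1 \<or> rademacher i x = - 1" by (simp add: rademacher_def)
    then show ?thesis
    proof
      assume "rademacher i x = 1"
      then show ?thesis unfolding c_def dens_Suc[OF assms(1), of ?m] by (simp add: *)
    next
      assume "rademacher i x = - 1"
      then show ?thesis unfolding c_def dens_Suc[OF assms(1), of ?m] by (simp add: *)
    qed
  qed
  have "mass U (i # is) = mass U is + (\<integral>x. c x * rademacher i x \<partial>unit_measure)" for i
  proof -
    have "integrable unit_measure (\<lambda>x. c x * rademacher i x)"
      using c by (intro integrable_unit_measure[where B = 1]) (auto simp: abs_mult)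
    then show ?thesis
      unfolding mass_def list.size add_Suc_right add_0_right eq
      by (intro Bochner_Integration.integral_add integrable_dens assms)
  qed
  then have "J = {i. 1 / 2 ^ n < (\<integral>x. c x * rademacher i x \<partial>unit_measure)}"
    unfolding J_def by simp
  then show "finite J" "card J \<le> 4 ^ n"
    using rademacher_bessel[of c n] c by auto
qed

section \<open>Functions with prescribed binary digits\<close>

abbreviation hist :: "(nat \<Rightarrow> nat) \<Rightarrow> nat \<Rightarrow> nat list" where
  "hist c n \<equiv> rev (map c [0..<n])"

text \<open>The real number whose successive binary digits come from the Rademacher functions with
  indices \<open>c 0\<close>, \<open>c 1\<close> and so on.\<close>

definition limit_point :: "(nat \<Rightarrow> nat) \<Rightarrow> real \<Rightarrow> real" where
  "limit_point c x = (SUP n. dyadic (hist c n) x / 2 ^ n)"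

lemma dyadic_nested:
  assumes "m \<le> n"
  shows "dyadic (hist c m) x / 2 ^ m \<le> dyadic (hist c n) x / 2 ^ n"
    and "(dyadic (hist c n) x + 1) / 2 ^ n \<le> (dyadic (hist c m) x + 1) / 2 ^ m"
  using assms
proof (induction rule: dec_induct)
  case (step n)
  {
    case 1
    have "dyadic (hist c n) x / 2 ^ n \<le> dyadic (hist c (Suc n)) x / 2 ^ Suc n"
      by (simp add: rademacher_def field_simps)
    then show ?case using step by linarith
  next
    case 2
    have "(dyadic (hist c (Suc n)) x + 1) / 2 ^ Suc n \<le> (dyadic (hist c n) x + 1) / 2 ^ n"
      by (simp add: rademacher_def field_simps)
    then show ?case using step by linarith
  }
qed auto

lemma dyadic_bounds:
  "dyadic (hist c m) x / 2 ^ m \<le> (dyadic (hist c n) x + 1) / 2 ^ n"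
proof -
  have "dyadic (hist c m) x / 2 ^ m \<le> dyadic (hist c (max m n)) x / 2 ^ max m n"
    by (rule dyadic_nested) simp
  also have "\<dots> \<le> (dyadic (hist c (max m n)) x + 1) / 2 ^ max m n"
    by (simp add: divide_right_mono)
  also have "\<dots> \<le> (dyadic (hist c n) x + 1) / 2 ^ n"
    by (rule dyadic_nested) simp
  finally show ?thesis .
qed

lemma bdd_above_dyadic: "bdd_above (range (\<lambda>n. dyadic (hist c n) x / 2 ^ n))"
  by (rule bdd_aboveI2) (rule dyadic_bounds[where n = 0])

lemma limit_point_bounds:
  "dyadic (hist c n) x / 2 ^ n \<le> limit_point c x"
  "limit_point c x \<le> (dyadic (hist c n) x + 1) / 2 ^ n"
  unfolding limit_point_def
  by (auto intro!: cSUP_upper cSUP_least bdd_above_dyadic dyadic_bounds)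

lemma borel_measurable_limit_point: "limit_point c \<in> borel_measurable borel"
  unfolding limit_point_def[abs_def]
  by (intro borel_measurable_cSUP bdd_above_dyadic) auto

text \<open>Where the graph lies in \<open>U\<close>, the density is eventually 1 by
  \<open>dens_open\<close>, so \<open>x\<close> belongs to the lower limit of the sets
  \<open>E n\<close>. Markov's inequality bounds \<open>E n\<close> by \<open>mass\<close>, and
  continuity from below passes to the limit.\<close>

lemma emeasure_graph_open:
  assumes "open U" and mass: "\<And>n. N \<le> n \<Longrightarrow> mass U (hist c n) \<le> e"
  shows "emeasure lborel {x \<in> {0..<1}. (x, limit_point c x) \<in> U} \<le> ennreal e"
proof -
  have U: "U \<in> sets borel" using assms(1) by simp
  define E where "E n = {x \<in> {0..<1}. dens U n (dyadic (hist c n) x) x = 1}" for n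
  have [measurable]: "E n \<in> sets borel" for n
    unfolding E_def using U by measurable
  have E: "emeasure lborel (E n) \<le> ennreal e" if "N \<le> n" for n
  proof -
    have "emeasure lborel (E n) = (\<integral>\<^sup>+x. indicator (E n) x \<partial>lborel)" by simp
    also have "\<dots> \<le> (\<integral>\<^sup>+x. ennreal (dens U n (dyadic (hist c n) x) x) * indicator {0..<1} x \<partial>lborel)"
      by (intro nn_integral_mono) (auto simp: E_def indicator_def)
    also have "\<dots> = (\<integral>\<^sup>+x. dens U n (dyadic (hist c n) x) x \<partial>unit_measure)"
      by (subst nn_integral_restrict_space) auto
    also have "\<dots> = ennreal (mass U (hist c n))"
      unfolding mass_def using integrable_dens[OF U] dens_nonneg
      by (subst nn_integral_eq_integral) auto
    also have "\<dots> \<le> ennreal e" using mass[OF that] by (rule ennreal_leI)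
    finally show ?thesis .
  qed
  have "emeasure lborel {x \<in> {0..<1}. (x, limit_point c x) \<in> U}
      \<le> emeasure lborel (\<Union>n. \<Inter>m\<in>{n..}. E m)"
  proof (rule emeasure_mono)
    show "{x \<in> {0..<1}. (x, limit_point c x) \<in> U} \<subseteq> (\<Union>n. \<Inter>m\<in>{n..}. E m)"
    proof
      fix x assume x: "x \<in> {x \<in> {0..<1}. (x, limit_point c x) \<in> U}"
      then have "eventually (\<lambda>n. dens U n (dyadic (hist c n) x) x = 1) sequentially"
        by (intro dens_open[OF assms(1), of _ "limit_point c x"] limit_point_bounds) auto
      then show "x \<in> (\<Union>n. \<Inter>m\<in>{n..}. E m)"
        using x unfolding eventually_sequentially E_def by auto
    qed
    show "(\<Union>n. \<Inter>m\<in>{n..}. E m) \<in> sets lborel" by measurable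
  qed
  also have "\<dots> = (SUP n. emeasure lborel (\<Inter>m\<in>{n..}. E m))"
  proof (rule SUP_emeasure_incseq[symmetric])
    show "range (\<lambda>n. \<Inter>m\<in>{n..}. E m) \<subseteq> sets lborel" by auto
    show "incseq (\<lambda>n. \<Inter>m\<in>{n..}. E m)" by (auto simp: incseq_def)
  qed
  also have "\<dots> \<le> ennreal e"
  proof (rule SUP_least)
    fix n
    have "emeasure lborel (\<Inter>m\<in>{n..}. E m) \<le> emeasure lborel (E (max n N))"
      by (rule emeasure_mono) auto
    also have "\<dots> \<le> ennreal e" by (rule E) simp
    finally show "emeasure lborel (\<Inter>m\<in>{n..}. E m) \<le> ennreal e" .
  qed
  finally show ?thesis .
qed

section \<open>Diagonalisation over blocks\<close>

definition prefixes :: "(nat \<Rightarrow> nat) \<Rightarrow> nat \<Rightarrow> nat list set" where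
  "prefixes f m = (\<lambda>\<eta>. map \<eta> [0..<m]) ` S f"

lemma finite_prefixes: "finite (prefixes f m)"
proof (rule finite_subset)
  show "prefixes f m \<subseteq> {p. set p \<subseteq> (\<Union>i<m. {..<f i}) \<and> length p = m}"
    unfolding prefixes_def S_def by fastforce
  show "finite {p. set p \<subseteq> (\<Union>i<m. {..<f i}) \<and> length p = m}"
    by (rule finite_lists_length_eq) simp
qed

text \<open>
  The \<open>n\<close>-th block \<open>{block f n..<block f (Suc n)}\<close> has a coordinate for each triple of an
  open set with index at most \<open>n\<close>, a prefix of length \<open>block f n\<close>, and one of the at most
  \<open>4 ^ n\<close> exceptional indices provided by \<open>mass_jump\<close>.
\<close>

primrec block :: "(nat \<Rightarrow> nat) \<Rightarrow> nat \<Rightarrow> nat" where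
  "block f 0 = 0"
| "block f (Suc n) = block f n + Suc n * (card (prefixes f (block f n)) * 4 ^ n)"

lemma block_mono: "m \<le> n \<Longrightarrow> block f m \<le> block f n"
  by (rule lift_Suc_mono_le[of "block f"]) auto

text \<open>The zero sequence supplies a prefix of each length, so no block is empty.\<close>

lemma le_block:
  assumes "\<forall>n. f n \<noteq> 0"
  shows "n \<le> block f n"
proof (induction n)
  case (Suc n)
  have "(\<lambda>_. 0) \<in> S f" using assms by (simp add: S_def)
  then have "0 < card (prefixes f (block f n))"
    using finite_prefixes by (auto simp: card_gt_0_iff prefixes_def)
  then have "0 < Suc n * (card (prefixes f (block f n)) * 4 ^ n)" by simp
  then show ?case using Suc unfolding block.simps by linarith
qed simp

text \<open>The prefix runs to the end of the \<open>n\<close>-th block, so that the code fixes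
  every value in the block where \<open>diagonal\<close> arranges agreement.\<close>

definition code :: "(nat \<Rightarrow> nat) \<Rightarrow> (nat \<Rightarrow> nat) \<Rightarrow> nat \<Rightarrow> nat" where
  "code f \<eta> n = to_nat (map \<eta> [0..<block f (Suc n)])"

lemma code_eqD:
  assumes "code f \<eta> n = code f \<eta>' n" and "j < block f (Suc n)"
  shows "\<eta> j = \<eta>' j"
proof -
  have "map \<eta> [0..<block f (Suc n)] = map \<eta>' [0..<block f (Suc n)]"
    using assms(1) unfolding code_def by simp
  then show ?thesis using assms(2) by (auto simp del: block.simps)
qed

text \<open>The codes before level \<open>n\<close> see only coordinates below
  \<open>block f n\<close>. Histories are thus counted before the length of the \<open>n\<close>-th
  block is chosen.\<close>

lemma finite_hist: "finite ((\<lambda>\<eta>. hist (code f \<eta>) n) ` S f)"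
  and card_hist_le: "card ((\<lambda>\<eta>. hist (code f \<eta>) n) ` S f) \<le> card (prefixes f (block f n))"
proof -
  let ?g = "\<lambda>p. hist (code f (nth p)) n"
  have "hist (code f \<eta>) n = ?g (map \<eta> [0..<block f n])" for \<eta>
  proof -
    have "code f \<eta> m = code f (nth (map \<eta> [0..<block f n])) m" if "m < n" for m
      unfolding code_def using block_mono[of "Suc m" n f] that
      by (auto intro!: arg_cong[where f = to_nat] simp del: block.simps)
    then show ?thesis by simp
  qed
  then have eq: "(\<lambda>\<eta>. hist (code f \<eta>) n) ` S f = ?g ` prefixes f (block f n)"
    unfolding prefixes_def image_image by (rule image_cong[OF refl])
  show "finite ((\<lambda>\<eta>. hist (code f \<eta>) n) ` S f)"
    unfolding eq by (intro finite_imageI finite_prefixes)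
  show "card ((\<lambda>\<eta>. hist (code f \<eta>) n) ` S f) \<le> card (prefixes f (block f n))"
    unfolding eq by (intro card_image_le finite_prefixes)
qed

text \<open>Each code in \<open>C n\<close> receives its own coordinate in the \<open>n\<close>-th
  block, and \<open>\<psi>\<close> copies there the value prescribed by the code.\<close>

lemma diagonal:
  assumes f: "\<forall>n. f n \<noteq> 0"
    and fin: "\<And>n. finite (C n)"
    and card: "\<And>n. card (C n) \<le> block f (Suc n) - block f n"
  obtains \<psi> where "\<psi> \<in> S f"
    and "\<And>\<eta> n. \<lbrakk>\<eta> \<in> S f; code f \<eta> n \<in> C n\<rbrakk> \<Longrightarrow> \<exists>j\<ge>block f n. \<eta> j = \<psi> j"
proof -
  have "\<forall>n. \<exists>e. inj_on e (C n) \<and> e ` C n \<subseteq> {block f n..<block f (Suc n)}"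
    using fin card by (metis card_atLeastLessThan card_le_inj finite_atLeastLessThan)
  then obtain e where inj: "\<And>n. inj_on (e n) (C n)"
    and e: "\<And>n. e n ` C n \<subseteq> {block f n..<block f (Suc n)}"
    by metis
  define Q where "Q j v \<longleftrightarrow> (\<exists>\<eta> n. \<eta> \<in> S f \<and> code f \<eta> n \<in> C n \<and> e n (code f \<eta> n) = j \<and> v = \<eta> j)"
    for j v
  have less: "m \<ge> n" if "i \<in> C m" "i' \<in> C n" "e m i = e n i'" for i i' m n
  proof (rule ccontr)
    assume "\<not> n \<le> m"
    then have "block f (Suc m) \<le> block f n" by (intro block_mono) simp
    moreover have "e m i < block f (Suc m)" "block f n \<le> e n i'"
      using e[of m] e[of n] that(1,2) by (auto simp del: block.simps)
    ultimately show False using that(3) by linarith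
  qed
  \<comment> \<open>The coordinate determines its block, injectivity the code, and the code the
    value; different \<open>\<eta>\<close> with one code make the same demand.\<close>
  have uniq: "v = w" if "Q j v" "Q j w" for j v w
  proof -
    obtain \<eta> n \<eta>' n' where *:
      "code f \<eta> n \<in> C n" "e n (code f \<eta> n) = j" "v = \<eta> j"
      "code f \<eta>' n' \<in> C n'" "e n' (code f \<eta>' n') = j" "w = \<eta>' j"
      using \<open>Q j v\<close> \<open>Q j w\<close> unfolding Q_def by blast
    have "n = n'" using less[of "code f \<eta> n" n "code f \<eta>' n'" n']
        less[of "code f \<eta>' n'" n' "code f \<eta> n" n] * by (intro antisym) auto
    then have "code f \<eta> n = code f \<eta>' n"
      using inj[of n] * by (metis inj_onD)
    moreover have "j < block f (Suc n)" using e[of n] * by (auto simp del: block.simps)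
    ultimately show ?thesis using code_eqD * by simp
  qed
  define \<psi> where "\<psi> j = (if \<exists>v. Q j v then SOME v. Q j v else 0)" for j
  have \<psi>: "\<psi> j = v" if "Q j v" for j v
    unfolding \<psi>_def using that uniq by (metis someI)
  show ?thesis
  proof
    have "\<psi> j < f j" for j
    proof (cases "\<exists>v. Q j v")
      case True
      then obtain v where "Q j v" by blast
      then have "v < f j" unfolding Q_def S_def by auto
      then show ?thesis using \<psi> \<open>Q j v\<close> by simp
    next
      case False
      then show ?thesis using f by (simp add: \<psi>_def)
    qed
    then show "\<psi> \<in> S f" by (simp add: S_def)
  next
    fix \<eta> n assume "\<eta> \<in> S f" and c: "code f \<eta> n \<in> C n"
    then have "Q (e n (code f \<eta> n)) (\<eta> (e n (code f \<eta> n)))" unfolding Q_def by blast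
    then have "\<eta> (e n (code f \<eta> n)) = \<psi> (e n (code f \<eta> n))" using \<psi> by simp
    moreover have "block f n \<le> e n (code f \<eta> n)"
      using e[of n] c by (auto simp del: block.simps)
    ultimately show "\<exists>j\<ge>block f n. \<eta> j = \<psi> j" by blast
  qed
qed

section \<open>Plane null sets and their open covers\<close>

lemma null_sets_lebesgue_open_cover:
  fixes H :: "'a::euclidean_space set"
  assumes "H \<in> null_sets lebesgue" and "0 < e"
  obtains U where "open U" and "H \<subseteq> U" and "emeasure lborel U \<le> ennreal e"
proof -
  obtain U where U: "open U" "H \<subseteq> U" "emeasure lebesgue (U - H) < ennreal e"
    using sets_lebesgue_outer_open[of H e] assms by (metis null_setsD2)
  have "emeasure lebesgue U = emeasure lebesgue (U - H)"
    using emeasure_Diff_null_set[OF assms(1), of U] U(1) by simp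
  then show ?thesis using that U by (simp add: less_imp_le)
qed

lemma capture_unit:
  fixes H :: "(real \<times> real) set"
  assumes f: "\<forall>n. f n \<noteq> 0" and H: "H \<in> null_sets lebesgue"
  obtains \<psi> where "\<psi> \<in> S f"
    and "\<And>\<eta>. \<lbrakk>\<eta> \<in> S f; \<not> R_ex \<eta> \<psi>\<rbrakk> \<Longrightarrow>
      {x \<in> {0..<1}. (x, limit_point (code f \<eta>) x) \<in> H} \<in> null_sets lebesgue"
proof -
  have "\<forall>k. \<exists>U. open U \<and> H \<subseteq> U \<and> emeasure lborel U \<le> ennreal (1 / 4 ^ k)"
    using null_sets_lebesgue_open_cover[OF H] by (metis zero_less_divide_1_iff zero_less_numeral zero_less_power)
  then obtain U where U: "\<And>k. open (U k)" "\<And>k. H \<subseteq> U k"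
    "\<And>k. emeasure lborel (U k) \<le> ennreal (1 / 4 ^ k)" by metis
  have bU: "U k \<in> sets borel" for k using U(1) by simp
  define T where "T n = (\<lambda>\<eta>. hist (code f \<eta>) n) ` S f" for n
  define J where "J n k h = {i. mass (U k) h + 1 / 2 ^ n < mass (U k) (i # h)}" for n k h
  \<comment> \<open>The cover \<open>U k\<close> enters only from level \<open>k\<close> on; at most
    \<open>Suc n\<close> covers, the histories and \<open>4 ^ n\<close> jumps each fit into the
    \<open>n\<close>-th block.\<close>
  define C where "C n = (\<Union>k\<in>{..n}. \<Union>h\<in>T n. J n k h)" for n
  have J: "finite (J n k h)" "card (J n k h) \<le> 4 ^ n" for n k h
    unfolding J_def by (rule mass_jump[OF bU])+
  have T: "finite (T n)" "card (T n) \<le> card (prefixes f (block f n))" for n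
    unfolding T_def by (rule finite_hist card_hist_le)+
  have "card (C n) \<le> block f (Suc n) - block f n" for n
  proof -
    have "card (\<Union>h\<in>T n. J n k h) \<le> card (prefixes f (block f n)) * 4 ^ n" for k
    proof -
      have "card (\<Union>h\<in>T n. J n k h) \<le> (\<Sum>h\<in>T n. card (J n k h))"
        by (rule card_UN_le[OF T(1)])
      also have "\<dots> \<le> card (T n) * 4 ^ n" using sum_bounded_above[OF J(2)] by simp
      also have "\<dots> \<le> card (prefixes f (block f n)) * 4 ^ n" using T(2) by simp
      finally show ?thesis .
    qed
    note * = this
    have "card (C n) \<le> (\<Sum>k\<in>{..n}. card (\<Union>h\<in>T n. J n k h))"
      unfolding C_def by (rule card_UN_le) simp
    also have "\<dots> \<le> card {..n} * (card (prefixes f (block f n)) * 4 ^ n)"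
      using sum_bounded_above[of "{..n}", OF *] by (simp only: of_nat_id)
    finally show ?thesis by simp
  qed
  moreover have "finite (C n)" for n unfolding C_def using T(1) J(1) by blast
  ultimately obtain \<psi> where \<psi>: "\<psi> \<in> S f"
    "\<And>\<eta> n. \<lbrakk>\<eta> \<in> S f; code f \<eta> n \<in> C n\<rbrakk> \<Longrightarrow> \<exists>j\<ge>block f n. \<eta> j = \<psi> j"
    using diagonal[OF f, of C] by blast
  show ?thesis
  proof (rule that[OF \<psi>(1)])
    fix \<eta> assume \<eta>: "\<eta> \<in> S f" and "\<not> R_ex \<eta> \<psi>"
    then obtain N where N: "\<And>j. N \<le> j \<Longrightarrow> \<eta> j \<noteq> \<psi> j"
      unfolding R_ex_def finite_nat_iff_bounded by (auto simp: subset_iff not_less[symmetric])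
    let ?c = "code f \<eta>"
    \<comment> \<open>Here \<open>N \<le> k \<le> n \<le> block f n\<close>, so an exceptional code
      at level \<open>n\<close> would force an agreement at or beyond \<open>N\<close>.\<close>
    have *: "mass (U k) (hist ?c (Suc n)) \<le> mass (U k) (hist ?c n) + 1 / 2 ^ n"
      if "N \<le> k" "k \<le> n" for k n
    proof -
      have "code f \<eta> n \<notin> C n"
        using \<psi>(2)[OF \<eta>, of n] N le_block[OF f, of n] that by (meson order_trans)
      then have "code f \<eta> n \<notin> J n k (hist ?c n)"
        using that(2) \<eta> unfolding C_def T_def by blast
      then show ?thesis unfolding J_def by simp
    qed
    \<comment> \<open>At \<open>n = k\<close> the bound equals \<open>1 / 2 ^ k\<close>; the term
      \<open>2 / 2 ^ n\<close> makes the increments \<open>1 / 2 ^ n\<close> telescope.\<close>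
    have "mass (U k) (hist ?c n) \<le> 3 / 2 ^ k - 2 / 2 ^ n" if "k \<le> n" "N \<le> k" for k n
      using that
    proof (induction rule: dec_induct)
      case base
      have "mass (U k) (hist ?c k) \<le> 2 ^ length (hist ?c k) * (1 / 4 ^ k)"
        by (rule mass_le[OF bU U(3)]) simp
      also have "\<dots> = 1 / 2 ^ k" by (simp add: field_simps flip: power_mult_distrib)
      finally show ?case by simp
    next
      case (step n)
      have "2 / 2 ^ Suc n = 1 / (2 ^ n :: real)" "2 / 2 ^ n = 1 / 2 ^ n + 1 / (2 ^ n :: real)"
        by simp_all
      then show ?case using step.IH[OF step.prems] "*"[OF step.prems step.hyps(1)] by linarith
    qed
    then have mass: "mass (U k) (hist ?c n) \<le> 3 / 2 ^ k" if "N \<le> k" "k \<le> n" for k n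
      using that by (smt (verit) divide_nonneg_nonneg zero_le_power)
    define A where "A k = {x \<in> {0..<1}. (x, limit_point ?c x) \<in> U k}" for k
    have [measurable]: "A k \<in> sets borel" for k
    proof -
      have "(\<lambda>x. (x, limit_point ?c x)) \<in> borel \<rightarrow>\<^sub>M borel"
        unfolding borel_prod[symmetric] using borel_measurable_limit_point by measurable
      from measurable_sets[OF this bU[of k]]
      have "(\<lambda>x. (x, limit_point ?c x)) -` U k \<inter> {0..<1} \<in> sets borel" by auto
      then show ?thesis unfolding A_def by (simp add: vimage_def Int_def conj_commute)
    qed
    \<comment> \<open>Only the covers with \<open>N \<le> k\<close> are controlled, but each
      contains \<open>H\<close> and their bounds tend to 0.\<close>
    let ?Z = "\<Inter>k\<in>{N..}. A k"
    have "emeasure lborel ?Z \<le> ennreal (3 * (1 / 2) ^ k)" if "N \<le> k" for k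
    proof -
      have "emeasure lborel ?Z \<le> emeasure lborel (A k)"
        by (rule emeasure_mono) (use that in auto)
      also have "\<dots> \<le> ennreal (3 / 2 ^ k)"
        unfolding A_def using mass[OF that] by (rule emeasure_graph_open[OF U(1)])
      finally show ?thesis by (simp add: power_one_over)
    qed
    moreover have "(\<lambda>k. ennreal (3 * (1 / 2) ^ k)) \<longlonglongrightarrow> ennreal (3 * 0)"
      by (intro tendsto_intros LIMSEQ_realpow_zero) auto
    ultimately have "emeasure lborel ?Z \<le> ennreal (3 * 0)"
      by (intro tendsto_lowerbound[where F = sequentially])
        (auto simp: eventually_sequentially)
    then have "?Z \<in> null_sets lborel" by (intro null_setsI) auto
    then have "?Z \<in> null_sets lebesgue" by (rule null_sets_completionI)
    moreover have "{x \<in> {0..<1}. (x, limit_point ?c x) \<in> H} \<subseteq> ?Z"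
      using U(2) by (auto simp: A_def)
    ultimately show "{x \<in> {0..<1}. (x, limit_point ?c x) \<in> H} \<in> null_sets lebesgue"
      by (meson negligible_iff_null_sets negligible_subset)
  qed
qed

section \<open>The cardinal inequalities\<close>

definition graph_fun :: "(nat \<Rightarrow> nat) \<Rightarrow> (nat \<Rightarrow> nat) \<Rightarrow> real \<Rightarrow> real" where
  "graph_fun f \<eta> x = limit_point (code f \<eta>) (frac x)"

lemma borel_measurable_graph_fun: "graph_fun f \<eta> \<in> borel_measurable borel"
proof -
  have "frac \<in> borel_measurable (borel :: real measure)" unfolding frac_def[abs_def] by measurable
  then show ?thesis
    unfolding graph_fun_def[abs_def]
    by (rule measurable_compose[OF _ borel_measurable_limit_point])
qed

text \<open>\<open>graph_fun\<close> has period 1, so the points over \<open>H\<close> are integer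
  translates of points of \<open>{0..<1}\<close> over the null set \<open>H'\<close>. Countably many
  translates of one null set cover them.\<close>

lemma capture:
  fixes H :: "(real \<times> real) set"
  assumes f: "\<forall>n. f n \<noteq> 0" and H: "H \<in> null_sets lebesgue"
  obtains \<psi> where "\<psi> \<in> S f"
    and "\<And>\<eta>. \<lbrakk>\<eta> \<in> S f; \<not> R_ex \<eta> \<psi>\<rbrakk> \<Longrightarrow> {x. (x, graph_fun f \<eta> x) \<in> H} \<in> null_sets lebesgue"
proof -
  define H' where "H' = (\<Union>m::int. (+) (of_int m, 0) ` H)"
  have "negligible H" using H by (simp add: negligible_iff_null_sets)
  then have "negligible H'"
    unfolding H'_def by (intro negligible_countable_Union) (auto intro!: negligible_translation)
  then have "H' \<in> null_sets lebesgue" by (simp add: negligible_iff_null_sets)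
  from capture_unit[OF f this] obtain \<psi> where \<psi>: "\<psi> \<in> S f"
    "\<And>\<eta>. \<lbrakk>\<eta> \<in> S f; \<not> R_ex \<eta> \<psi>\<rbrakk> \<Longrightarrow>
      {x \<in> {0..<1}. (x, limit_point (code f \<eta>) x) \<in> H'} \<in> null_sets lebesgue"
    by blast
  show ?thesis
  proof (rule that[OF \<psi>(1)])
    fix \<eta> assume \<eta>: "\<eta> \<in> S f" "\<not> R_ex \<eta> \<psi>"
    let ?Z = "{x \<in> {0..<1}. (x, limit_point (code f \<eta>) x) \<in> H'}"
    have "negligible ?Z" using \<psi>(2)[OF \<eta>] by (simp add: negligible_iff_null_sets)
    then have "negligible (\<Union>m::int. (+) (of_int m) ` ?Z)"
      by (intro negligible_countable_Union) (auto intro!: negligible_translation)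
    moreover have "{x. (x, graph_fun f \<eta> x) \<in> H} \<subseteq> (\<Union>m::int. (+) (of_int m) ` ?Z)"
    proof
      fix x assume "x \<in> {x. (x, graph_fun f \<eta> x) \<in> H}"
      then have "(of_int (- \<lfloor>x\<rfloor>), 0) + (x, graph_fun f \<eta> x) \<in> H'"
        unfolding H'_def by blast
      then have "(frac x, limit_point (code f \<eta>) (frac x)) \<in> H'"
        by (simp add: graph_fun_def frac_def)
      then have "frac x \<in> ?Z" by (simp add: frac_lt_1)
      moreover have "x = of_int \<lfloor>x\<rfloor> + frac x" by (simp add: frac_def)
      ultimately show "x \<in> (\<Union>m::int. (+) (of_int m) ` ?Z)" by blast
    qed
    ultimately show "{x. (x, graph_fun f \<eta> x) \<in> H} \<in> null_sets lebesgue"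
      using negligible_subset negligible_iff_null_sets by blast
  qed
qed

text \<open>If \<open>H\<close> in \<open>\<A>\<close> meets the graph of
  \<open>graph_fun f \<eta>\<close> over a non-null set, then the \<open>\<psi>\<close> captured
  from \<open>H\<close> agrees infinitely often with \<open>\<eta>\<close>; these
  \<open>\<psi>\<close> therefore dominate.\<close>

lemma d_R_le_cov_star_family:
  assumes f: "\<forall>n. f n \<noteq> 0" and A: "cov_star_family \<A>"
  shows "d_R f \<le>o |\<A>|"
proof -
  have null: "\<And>H. H \<in> \<A> \<Longrightarrow> H \<in> null_sets lebesgue"
    using A unfolding cov_star_family_def by blast
  have "\<forall>H\<in>\<A>. \<exists>\<psi>. \<psi> \<in> S f \<and> (\<forall>\<eta>\<in>S f. \<not> R_ex \<eta> \<psi> \<longrightarrow>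
      {x. (x, graph_fun f \<eta> x) \<in> H} \<in> null_sets lebesgue)"
    using capture[OF f null] by metis
  then obtain \<psi> where \<psi>: "\<And>H. H \<in> \<A> \<Longrightarrow> \<psi> H \<in> S f"
    "\<And>H \<eta>. \<lbrakk>H \<in> \<A>; \<eta> \<in> S f; \<not> R_ex \<eta> (\<psi> H)\<rbrakk> \<Longrightarrow>
      {x. (x, graph_fun f \<eta> x) \<in> H} \<in> null_sets lebesgue"
    by metis
  have "dominating f (\<psi> ` \<A>)"
    unfolding dominating_def
  proof (intro conjI ballI)
    show "\<psi> ` \<A> \<subseteq> S f" using \<psi>(1) by blast
    fix \<eta> assume \<eta>: "\<eta> \<in> S f"
    have "UNIV \<in> sets borel - null_sets (lebesgue :: real measure)"
      by (auto simp: null_sets_def)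
    then obtain H where "H \<in> \<A>" "{x \<in> UNIV. (x, graph_fun f \<eta> x) \<in> H} \<notin> null_sets lebesgue"
      using A borel_measurable_graph_fun[of f \<eta>] unfolding cov_star_family_def by blast
    then show "\<exists>y\<in>\<psi> ` \<A>. R_ex \<eta> y" using \<psi>(2)[OF _ \<eta>] by auto
  qed
  then have "d_R f \<le>o |\<psi> ` \<A>|"
    unfolding d_R_def by (intro card_Inf(2)) (auto simp: card_of_Card_order)
  then show ?thesis using card_of_image ordLeq_transitive by blast
qed

text \<open>Dually, some \<open>\<eta>\<close> in \<open>X\<close> is unrelated to the
  \<open>\<psi>\<close> captured from \<open>H\<close>, so its graph avoids \<open>H\<close> over
  almost all of any \<open>B\<close>.\<close>

lemma non_star_le_unbounded:
  assumes f: "\<forall>n. f n \<noteq> 0" and X: "unbounded f X"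
  shows "non_star \<le>o |X|"
proof -
  have "non_star_family (graph_fun f ` X)"
    unfolding non_star_family_def
  proof (intro conjI ballI)
    show "graph_fun f ` X \<subseteq> borel \<rightarrow>\<^sub>M borel" using borel_measurable_graph_fun by blast
    fix H :: "(real \<times> real) set" and B :: "real set"
    assume H: "H \<in> null_sets lebesgue" and B: "B \<in> sets borel - null_sets lebesgue"
    obtain \<psi> where \<psi>: "\<psi> \<in> S f" "\<And>\<eta>. \<lbrakk>\<eta> \<in> S f; \<not> R_ex \<eta> \<psi>\<rbrakk> \<Longrightarrow>
        {x. (x, graph_fun f \<eta> x) \<in> H} \<in> null_sets lebesgue"
      using capture[OF f H] by blast
    obtain \<eta> where \<eta>: "\<eta> \<in> X" "\<not> R_ex \<eta> \<psi>" "\<eta> \<in> S f"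
      using X \<psi>(1) unfolding unbounded_def by blast
    have "{x \<in> B. (x, graph_fun f \<eta> x) \<notin> H} \<notin> null_sets lebesgue"
    proof
      assume "{x \<in> B. (x, graph_fun f \<eta> x) \<notin> H} \<in> null_sets lebesgue"
      then have "negligible ({x \<in> B. (x, graph_fun f \<eta> x) \<notin> H} \<union> {x. (x, graph_fun f \<eta> x) \<in> H})"
        using \<psi>(2)[OF \<eta>(3,2)] by (intro negligible_Un) (simp_all add: negligible_iff_null_sets)
      then have "negligible B" by (rule negligible_subset) auto
      then show False using B by (simp add: negligible_iff_null_sets)
    qed
    then show "\<exists>g\<in>graph_fun f ` X. {x \<in> B. (x, g x) \<notin> H} \<notin> null_sets lebesgue"
      using \<eta>(1) by blast
  qed
  then have "non_star \<le>o |graph_fun f ` X|"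
    unfolding non_star_def by (intro card_Inf(2)) (auto simp: card_of_Card_order)
  then show ?thesis using card_of_image ordLeq_transitive by blast
qed

theorem theorem3p3:
  "kappa_star \<le>o cov_star \<and> non_star \<le>o lambda_star"
proof
  have "cov_star \<in> {|\<A>| |\<A>. cov_star_family \<A>}"
    unfolding cov_star_def using cov_star_family_null_sets
    by (intro card_Inf(1)) (auto simp: card_of_Card_order)
  then obtain \<A> where \<A>: "cov_star = |\<A>|" "cov_star_family \<A>" by blast
  have "Card_order (d_R f)" for f
  proof -
    have "d_R f \<in> {|Y| |Y. dominating f Y}"
      unfolding d_R_def using dominating_S by (intro card_Inf(1)) (auto simp: card_of_Card_order)
    then show ?thesis using card_of_Card_order by auto
  qed
  then show "kappa_star \<le>o cov_star"
    unfolding kappa_star_def \<A>(1) using d_R_le_cov_star_family[OF _ \<A>(2)]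
    by (intro card_Sup_least) (auto simp: card_of_Card_order)
next
  have b_R: "b_R f \<in> {|X| |X. unbounded f X}" if "\<exists>X. unbounded f X" for f
    unfolding b_R_def using that by (intro card_Inf(1)) (auto simp: card_of_Card_order)
  let ?R = "{b_R f |f. (\<forall>n. f n \<noteq> 0) \<and> (\<exists>X. unbounded f X)}"
  have "lambda_star \<in> ?R"
    unfolding lambda_star_def
  proof (rule card_Inf(1))
    \<comment> \<open>The constant 2 never takes the value 1, so it contributes to the infimum,
      which is therefore attained.\<close>
    have "\<exists>X. unbounded (\<lambda>_. 2) X" by (subst unbounded_S_iff) auto
    then have "b_R (\<lambda>_. 2) \<in> ?R" by (intro CollectI exI[of _ "\<lambda>_. 2"]) auto
    then show "?R \<noteq> {}" by blast
    fix r assume "r \<in> ?R"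
    then obtain f where "r = b_R f" "\<exists>X. unbounded f X" by blast
    then show "Card_order r" using b_R[of f] card_of_Card_order by auto
  qed
  then obtain f where f: "lambda_star = b_R f" "\<forall>n. f n \<noteq> 0" "\<exists>X. unbounded f X" by blast
  then obtain X where "b_R f = |X|" "unbounded f X" using b_R[of f] by blast
  then show "non_star \<le>o lambda_star" using non_star_le_unbounded[OF f(2)] unfolding f(1) by simp
qed

end
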